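(* Let $t = 10\sqrt{5} - 22$ and define, for real $x,y,z,w$, $$F_3(x,y,z,w) = (t + x^2)(t + z^2)(y^2 + w^2).$$ Let $D \subset \mathbb{R}^4$ be the set of $(x,y,z,w)$ satisfying $$-2 \le x + y \le 2,\quad -2 \le x - y \le 2,\quad -2 \le z + w \le 2,\quad -2 \le z - w \le 2.$$ Then $$\max_{(x,y,z,w)\in D} F_3(x,y,z,w) = 64\left(56 - 25\sqrt{5}\right).$$ *)

theory Defs
  imports Complex_Main
begin

definition t :: real where
  "t = 10 * sqrt 5 - 22"

definition F\<^sub>3 :: "real \<times> real \<times> real \<times> real \<Rightarrow> real" where
  "F\<^sub>3 = (\<lambda>(x, y, z, w). (t + x\<^sup>2) * (t + z\<^sup>2) * (y\<^sup>2 + w\<^sup>2))"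

definition D :: "(real \<times> real \<times> real \<times> real) set" where
  "D = {(x, y, z, w).
     -2 \<le> x + y \<and> x + y \<le> 2 \<and> -2 \<le> x - y \<and> x - y \<le> 2 \<and>
     -2 \<le> z + w \<and> z + w \<le> 2 \<and> -2 \<le> z - w \<and> z - w \<le> 2}"

text \<open>
  The maximum of a function over a possibly infinite set, as an attained upper bound;
  the library constant \<^const>\<open>Max\<close> is meaningful for finite sets only.
\<close>

definition is_max_on :: "('a \<Rightarrow> real) \<Rightarrow> 'a set \<Rightarrow> real \<Rightarrow> bool" where
  "is_max_on f S m \<longleftrightarrow> (\<exists>p\<in>S. f p = m) \<and> (\<forall>p\<in>S. f p \<le> m)"

end

theory Submission
  imports Defs
begin

text \<open>
  On \<open>D\<close> one has \<open>|y| \<le> 2 - |x|\<close> and \<open>|w| \<le> 2 - |z|\<close>, so with \<open>a = |x|\<close>, \<open>b = |z|\<close> it suffices to bound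
  \<open>(t + a\<^sup>2) (t + b\<^sup>2) ((2 - a)\<^sup>2 + (2 - b)\<^sup>2)\<close> for \<open>0 \<le> b \<le> a \<le> 2\<close>; the target is \<open>(t + 4) 4t\<close>.
  Compare \<open>(2 - b)\<^sup>2 (2 + a)\<close> with \<open>(t + a\<^sup>2) (2 - a)\<close>. If the former is larger, replacing \<open>a\<close> by \<open>2\<close>
  does not decrease the function, and \<open>(t + b\<^sup>2) (2 - b)\<^sup>2 \<le> 4t\<close> finishes; equality holds at
  \<open>b = 0\<close> and \<open>b = 3 - \<surd>5\<close>. Otherwise the function is at most
  \<open>(t + 4) (t + a\<^sup>2)\<^sup>2 (2 - a) / (2 + a)\<close>, and \<open>(t + a\<^sup>2)\<^sup>2 (2 - a) \<le> 4t (2 + a)\<close>.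
\<close>

lemma t_bounds: "36/100 \<le> t" "t \<le> 361/1000"
proof -
  have "2236/1000 \<le> sqrt 5"
    by (rule real_le_rsqrt) (simp add: power2_eq_square)
  moreover have "sqrt 5 \<le> 22361/10000"
    by (rule real_le_lsqrt) (simp_all add: power2_eq_square)
  ultimately show "36/100 \<le> t" "t \<le> 361/1000"
    unfolding t_def by linarith+
qed

lemma max_value_eq: "64 * (56 - 25 * sqrt 5) = (t + 4) * (4 * t)"
  unfolding t_def by (simp add: algebra_simps)

text \<open>This choice of \<open>t\<close> makes \<open>b = 3 - sqrt 5\<close> a double root of the
  difference of the two sides; the remaining factor is nonnegative since
  \<open>b \<le> 2 \<le> 2 * s - 2\<close>.\<close>

lemma quartic_le:
  assumes "0 \<le> b" "b \<le> 2"
  shows "(t + b\<^sup>2) * (2 - b)\<^sup>2 \<le> 4 * t"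
proof -
  define s where "s = sqrt 5"
  have s: "s * s = 5" "2 \<le> s"
    by (auto simp: s_def intro: real_le_rsqrt)
  \<comment> \<open>\<open>algebra_simps\<close> nests products to the right, so
    \<open>s * s = 5\<close> is also needed in this form.\<close>
  have ss: "s * (s * c) = 5 * c" for c
    by (simp flip: mult.assoc add: s(1))
  have "4 * t - (t + b\<^sup>2) * (2 - b)\<^sup>2 = b * (b - (3 - s))\<^sup>2 * (2 * s - 2 - b)"
    unfolding t_def s_def[symmetric]
    by (simp add: power2_eq_square algebra_simps s(1) ss)
  moreover have "0 \<le> b * (b - (3 - s))\<^sup>2 * (2 * s - 2 - b)"
    using assms s by simp
  ultimately show ?thesis
    by linarith
qed

text \<open>Here the double root is \<open>a = sqrt 5 - 1\<close>, and the other factor is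
  nonnegative.\<close>

lemma cubic_le:
  assumes "0 \<le> a"
  shows "(t + a\<^sup>2) * (2 - a) \<le> 4 * t"
proof -
  define s where "s = sqrt 5"
  have s: "s * s = 5" "2 \<le> s"
    by (auto simp: s_def intro: real_le_rsqrt)
  have ss: "s * (s * c) = 5 * c" for c
    by (simp flip: mult.assoc add: s(1))
  have "4 * t - (t + a\<^sup>2) * (2 - a) = (a - (s - 1))\<^sup>2 * (a + (2 * s - 4))"
    unfolding t_def s_def[symmetric]
    by (simp add: power2_eq_square algebra_simps s(1) ss)
  moreover have "0 \<le> (a - (s - 1))\<^sup>2 * (a + (2 * s - 4))"
    using assms s by simp
  ultimately show ?thesis
    by linarith
qed

text \<open>Up to \<open>9/5\<close>, \<open>cubic_le\<close> is multiplied by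
  \<open>t + a\<^sup>2 \<le> 2 + a\<close>. Beyond it, \<open>2 - a\<close> is so small that
  numerical bounds suffice.\<close>

lemma quintic_le:
  assumes "0 \<le> a" "a \<le> 2"
  shows "(t + a\<^sup>2)\<^sup>2 * (2 - a) \<le> 4 * t * (2 + a)"
proof (cases "a \<le> 9/5")
  case True
  have "a * a \<le> 9/5 * a"
    using True assms by (intro mult_right_mono)
  then have "t + a\<^sup>2 \<le> 2 + a"
    using t_bounds True unfolding power2_eq_square by linarith
  then have "(t + a\<^sup>2) * (2 - a) * (t + a\<^sup>2) \<le> 4 * t * (2 + a)"
    by (rule mult_mono[OF cubic_le[OF assms(1)]]) (use assms t_bounds in simp_all)
  then show ?thesis
    by (simp add: power2_eq_square algebra_simps)
next
  case False
  have "a\<^sup>2 \<le> 2\<^sup>2"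
    using assms by (intro power_mono)
  then have "(t + a\<^sup>2)\<^sup>2 \<le> (4361/1000)\<^sup>2"
    using t_bounds by (intro power_mono) auto
  then have "(t + a\<^sup>2)\<^sup>2 * (2 - a) \<le> 20 * (1/5)"
    using False assms by (intro mult_mono) (auto simp: power2_eq_square)
  also have "\<dots> \<le> 4 * (36/100) * (2 + a)"
    using False by simp
  also have "\<dots> \<le> 4 * t * (2 + a)"
    using t_bounds assms by (intro mult_right_mono) auto
  finally show ?thesis .
qed

lemma reduced_bound_ordered:
  assumes "0 \<le> b" "b \<le> a" "a \<le> 2"
  shows "(t + a\<^sup>2) * (t + b\<^sup>2) * ((2 - a)\<^sup>2 + (2 - b)\<^sup>2) \<le> (t + 4) * (4 * t)"
proof (cases "(t + a\<^sup>2) * (2 - a) \<le> (2 - b)\<^sup>2 * (2 + a)")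
  case True
  \<comment> \<open>Raising \<open>a\<close> to 2 gains
    \<open>(4 - a\<^sup>2) * (2 - b)\<^sup>2\<close> and loses
    \<open>(t + a\<^sup>2) * (2 - a)\<^sup>2\<close>; after removing \<open>2 - a\<close>, the case
    condition compares the two.\<close>
  have "(t + 4) * (2 - b)\<^sup>2 - (t + a\<^sup>2) * ((2 - a)\<^sup>2 + (2 - b)\<^sup>2)
      = (2 - a) * ((2 - b)\<^sup>2 * (2 + a) - (t + a\<^sup>2) * (2 - a))"
    by algebra
  moreover have "0 \<le> (2 - a) * ((2 - b)\<^sup>2 * (2 + a) - (t + a\<^sup>2) * (2 - a))"
    using True assms by simp
  ultimately have "(t + a\<^sup>2) * ((2 - a)\<^sup>2 + (2 - b)\<^sup>2) \<le> (t + 4) * (2 - b)\<^sup>2"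
    by linarith
  then have "(t + b\<^sup>2) * ((t + a\<^sup>2) * ((2 - a)\<^sup>2 + (2 - b)\<^sup>2)) \<le> (t + b\<^sup>2) * ((t + 4) * (2 - b)\<^sup>2)"
    using t_bounds by (intro mult_left_mono) auto
  also have "\<dots> = (t + 4) * ((t + b\<^sup>2) * (2 - b)\<^sup>2)"
    by simp
  also have "\<dots> \<le> (t + 4) * (4 * t)"
    using quartic_le[of b] assms t_bounds by (intro mult_left_mono) auto
  finally show ?thesis
    by (simp only: mult_ac)
next
  case False
  \<comment> \<open>Multiplying by \<open>2 + a\<close> avoids division and makes
    \<open>a\<^sup>2\<close> cancel in the next step.\<close>
  have "((2 - a)\<^sup>2 + (2 - b)\<^sup>2) * (2 + a) \<le> (2 - a)\<^sup>2 * (2 + a) + (t + a\<^sup>2) * (2 - a)"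
    using False by (simp add: distrib_right)
  also have "\<dots> = (t + 4) * (2 - a)"
    by algebra
  finally have *: "((2 - a)\<^sup>2 + (2 - b)\<^sup>2) * (2 + a) \<le> (t + 4) * (2 - a)" .
  have "b\<^sup>2 \<le> a\<^sup>2"
    using assms by (intro power_mono)
  then have "(t + a\<^sup>2) * (t + b\<^sup>2) \<le> (t + a\<^sup>2)\<^sup>2"
    using t_bounds by (simp add: power2_eq_square[of "t + a\<^sup>2"] mult_left_mono)
  then have "(t + a\<^sup>2) * (t + b\<^sup>2) * (((2 - a)\<^sup>2 + (2 - b)\<^sup>2) * (2 + a))
      \<le> (t + a\<^sup>2)\<^sup>2 * ((t + 4) * (2 - a))"
    by (rule mult_mono[OF _ *]) (use assms in simp_all)
  also have "\<dots> = (t + 4) * ((t + a\<^sup>2)\<^sup>2 * (2 - a))"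
    by simp
  also have "\<dots> \<le> (t + 4) * (4 * t * (2 + a))"
    using quintic_le[of a] assms t_bounds by (intro mult_left_mono) auto
  finally have "(t + a\<^sup>2) * (t + b\<^sup>2) * ((2 - a)\<^sup>2 + (2 - b)\<^sup>2) * (2 + a) \<le> (t + 4) * (4 * t) * (2 + a)"
    by (simp only: mult.assoc)
  then show ?thesis
    by (rule mult_right_le_imp_le) (use assms in simp)
qed

lemma reduced_bound:
  assumes "0 \<le> a" "a \<le> 2" "0 \<le> b" "b \<le> 2"
  shows "(t + a\<^sup>2) * (t + b\<^sup>2) * ((2 - a)\<^sup>2 + (2 - b)\<^sup>2) \<le> (t + 4) * (4 * t)"
proof (cases "b \<le> a")
  case True
  then show ?thesis
    using reduced_bound_ordered assms by blast
next
  case False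
  then have "(t + b\<^sup>2) * (t + a\<^sup>2) * ((2 - b)\<^sup>2 + (2 - a)\<^sup>2) \<le> (t + 4) * (4 * t)"
    using reduced_bound_ordered[of a b] assms by simp
  then show ?thesis
    by (simp only: mult.commute add.commute)
qed

lemma F\<^sub>3_le:
  assumes "(x, y, z, w) \<in> D"
  shows "F\<^sub>3 (x, y, z, w) \<le> (t + 4) * (4 * t)"
proof -
  have xy: "\<bar>y\<bar> \<le> 2 - \<bar>x\<bar>" and zw: "\<bar>w\<bar> \<le> 2 - \<bar>z\<bar>"
    using assms by (auto simp: D_def abs_if)
  have "y\<^sup>2 \<le> (2 - \<bar>x\<bar>)\<^sup>2" "w\<^sup>2 \<le> (2 - \<bar>z\<bar>)\<^sup>2"
    using power_mono[OF xy, of 2] power_mono[OF zw, of 2] by simp_all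
  then have "F\<^sub>3 (x, y, z, w) \<le> (t + \<bar>x\<bar>\<^sup>2) * (t + \<bar>z\<bar>\<^sup>2) * ((2 - \<bar>x\<bar>)\<^sup>2 + (2 - \<bar>z\<bar>)\<^sup>2)"
    unfolding F\<^sub>3_def using t_bounds by (auto intro!: mult_left_mono add_mono)
  also have "\<dots> \<le> (t + 4) * (4 * t)"
    using xy zw by (intro reduced_bound) linarith+
  finally show ?thesis .
qed

theorem mainTheorem1:
  shows "is_max_on F\<^sub>3 D (64 * (56 - 25 * sqrt 5))"
  unfolding is_max_on_def max_value_eq
proof (intro conjI ballI bexI)
  \<comment> \<open>This is the equality case \<open>a = 2\<close>, \<open>b = 0\<close>.\<close>
  show "F\<^sub>3 (2, 0, 0, 2) = (t + 4) * (4 * t)"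
    by (simp add: F\<^sub>3_def)
  show "(2, 0, 0, 2) \<in> D"
    by (simp add: D_def)
  show "F\<^sub>3 p \<le> (t + 4) * (4 * t)" if "p \<in> D" for p
    using that F\<^sub>3_le by (cases p) auto
qed

end
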